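(* Let $G$ be a finite simple connected graph. Then $$DSO(G)\le \sqrt{\frac{H(G)}{2} \left(M_1(G)-2\,ISI(G)\right)}.$$ Equality holds if and only if $G$ is either a regular graph or a bipartite semiregular graph.
   Context: For a finite simple graph $G=(V(G),E(G))$, $d_u$ denotes the degree of the vertex $u$. The Diminished Sombor index is $DSO(G)=\sum_{uv\in E(G)}\frac{\sqrt{d_u^2+d_v^2}}{d_u+d_v}$. The first Zagreb index is $M_1(G)=\sum_{v\in V(G)} d_v^2=\sum_{uv\in E(G)}(d_u+d_v)$, the harmonic index is $H(G)=\sum_{uv\in E(G)}\frac{2}{d_u+d_v}$, and the inverse sum index is $ISI(G)=\sum_{uv\in E(G)}\frac{d_u d_v}{d_u+d_v}$. A graph is bipartite semiregular if it is bipartite with a bipartition $(A,B)$ such that all vertices of $A$ have the same degree and all vertices of $B$ have the same degree. *)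

theory Defs
  imports Complex_Main "Graph_Theory.Graph_Theory"
begin

text \<open>
  A finite simple graph is a \<^locale>\<open>pair_graph\<close>: a finite loop-free digraph with a symmetric
  arc set and no parallel arcs. Each undirected edge therefore occurs as two arcs, and sums over
  the edges have to range over unordered pairs.
\<close>

definition uedges :: "'a pair_pre_digraph \<Rightarrow> 'a set set" where
  "uedges G = {{u, v} | u v. (u, v) \<in> parcs G}"

text \<open>By symmetry of the arc set, the out-degree is the number of neighbours.\<close>

definition vdegree :: "'a pair_pre_digraph \<Rightarrow> 'a \<Rightarrow> nat" where
  "vdegree G v = out_degree (with_proj G) v"

text \<open>
  Edges are two-element sets, since there are no loops. So for an edge \<open>e = {u, v}\<close>, the
  inner sums and products over \<open>w \<in> e\<close> below are \<open>d u + d v\<close>,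
  \<open>(d u)\<^sup>2 + (d v)\<^sup>2\<close> and \<open>d u * d v\<close>, where \<open>d\<close> is the degree.
\<close>

definition diminished_sombor :: "'a pair_pre_digraph \<Rightarrow> real" where
  "diminished_sombor G =
    (\<Sum>e\<in>uedges G. sqrt (\<Sum>w\<in>e. (real (vdegree G w))\<^sup>2) / (\<Sum>w\<in>e. real (vdegree G w)))"

definition first_zagreb :: "'a pair_pre_digraph \<Rightarrow> real" where
  "first_zagreb G = (\<Sum>v\<in>pverts G. (real (vdegree G v))\<^sup>2)"

definition harmonic_index :: "'a pair_pre_digraph \<Rightarrow> real" where
  "harmonic_index G = (\<Sum>e\<in>uedges G. 2 / (\<Sum>w\<in>e. real (vdegree G w)))"

definition inverse_sum_index :: "'a pair_pre_digraph \<Rightarrow> real" where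
  "inverse_sum_index G =
    (\<Sum>e\<in>uedges G. (\<Prod>w\<in>e. real (vdegree G w)) / (\<Sum>w\<in>e. real (vdegree G w)))"

definition regular_graph :: "'a pair_pre_digraph \<Rightarrow> bool" where
  "regular_graph G \<longleftrightarrow> (\<exists>k. \<forall>v\<in>pverts G. vdegree G v = k)"

definition bipartition :: "'a pair_pre_digraph \<Rightarrow> 'a set \<Rightarrow> 'a set \<Rightarrow> bool" where
  "bipartition G A B \<longleftrightarrow>
    A \<union> B = pverts G \<and> A \<inter> B = {} \<and> parcs G \<subseteq> A \<times> B \<union> B \<times> A"

definition bipartite_semiregular :: "'a pair_pre_digraph \<Rightarrow> bool" where
  "bipartite_semiregular G \<longleftrightarrow>
    (\<exists>A B a b. bipartition G A B \<and>
      (\<forall>v\<in>A. vdegree G v = a) \<and> (\<forall>v\<in>B. vdegree G v = b))"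

end

theory Submission
  imports Defs
begin

text \<open>
  Write \<open>d\<close> for the degree, and for an edge \<open>e = uv\<close> put \<open>s e = d u + d v\<close> and
  \<open>q e = sqrt ((d u)\<^sup>2 + (d v)\<^sup>2)\<close>. Give \<open>e\<close> the positive weight \<open>w e = 1 / s e\<close>. Then
  the Diminished Sombor index is \<open>\<Sum> w q\<close> and half the harmonic index is \<open>\<Sum> w\<close>. Since
  \<open>(q e)\<^sup>2 = (s e)\<^sup>2 - 2 (d u) (d v)\<close>, also \<open>\<Sum> w q\<^sup>2 = \<Sum> s - 2 ISI\<close>, and counting the
  incidences of vertices and edges shows \<open>\<Sum> s = M\<^sub>1\<close>. The inequality is therefore the
  Cauchy-Schwarz inequality \<open>(\<Sum> w q)\<^sup>2 \<le> (\<Sum> w) (\<Sum> w q\<^sup>2)\<close>. The difference of its two sides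
  is the weighted variance of \<open>q\<close>, so equality holds exactly if \<open>q\<close> is constant on the edges.

  It remains to find the connected graphs on which \<open>(d u)\<^sup>2 + (d v)\<^sup>2\<close> has one value \<open>c\<close> for all
  edges \<open>uv\<close>. There the degree of a vertex determines the degree of each of its
  neighbours, so from an edge with degrees \<open>a\<close> and \<open>b\<close> only these two values can spread over
  the graph. If \<open>a = b\<close>, then the graph is regular. Otherwise no edge joins two vertices of the
  same degree, because \<open>2 a\<^sup>2\<close> and \<open>2 b\<^sup>2\<close> differ from \<open>c = a\<^sup>2 + b\<^sup>2\<close>, and the two degree classes
  form a semiregular bipartition.
\<close>

section \<open>Cauchy-Schwarz as a weighted variance\<close>

lemma weighted_variance_identity:
  fixes w q :: "'e \<Rightarrow> real"
  shows "(\<Sum>i\<in>E. \<Sum>j\<in>E. w i * w j * (q i - q j)\<^sup>2)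
    = 2 * ((\<Sum>e\<in>E. w e) * (\<Sum>e\<in>E. w e * (q e)\<^sup>2) - (\<Sum>e\<in>E. w e * q e)\<^sup>2)"
proof -
  have "(\<Sum>i\<in>E. \<Sum>j\<in>E. w i * w j * (q i - q j)\<^sup>2)
      = (\<Sum>i\<in>E. \<Sum>j\<in>E. (w i * (q i)\<^sup>2) * w j) + (\<Sum>i\<in>E. \<Sum>j\<in>E. w i * (w j * (q j)\<^sup>2))
        - 2 * (\<Sum>i\<in>E. \<Sum>j\<in>E. (w i * q i) * (w j * q j))"
    by (simp add: sum_distrib_left flip: sum.distrib sum_subtractf)
       (simp add: power2_eq_square algebra_simps)
  also have "\<dots> = 2 * ((\<Sum>e\<in>E. w e) * (\<Sum>e\<in>E. w e * (q e)\<^sup>2) - (\<Sum>e\<in>E. w e * q e)\<^sup>2)"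
    by (simp add: power2_eq_square flip: sum_product)
  finally show ?thesis .
qed

lemma weighted_Cauchy_Schwarz:
  fixes w q :: "'e \<Rightarrow> real"
  assumes "\<And>e. e \<in> E \<Longrightarrow> w e > 0"
  shows "(\<Sum>e\<in>E. w e * q e)\<^sup>2 \<le> (\<Sum>e\<in>E. w e) * (\<Sum>e\<in>E. w e * (q e)\<^sup>2)"
proof -
  have "(\<Sum>i\<in>E. \<Sum>j\<in>E. w i * w j * (q i - q j)\<^sup>2) \<ge> 0"
    using assms by (intro sum_nonneg) (simp add: less_imp_le)
  then show ?thesis
    unfolding weighted_variance_identity by simp
qed

lemma weighted_Cauchy_Schwarz_eq_iff:
  fixes w q :: "'e \<Rightarrow> real"
  assumes "finite E" and pos: "\<And>e. e \<in> E \<Longrightarrow> w e > 0"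
  shows "(\<Sum>e\<in>E. w e * q e)\<^sup>2 = (\<Sum>e\<in>E. w e) * (\<Sum>e\<in>E. w e * (q e)\<^sup>2)
    \<longleftrightarrow> (\<forall>i\<in>E. \<forall>j\<in>E. q i = q j)"
proof -
  have nonneg: "w i * w j * (q i - q j)\<^sup>2 \<ge> 0" if "i \<in> E" "j \<in> E" for i j
    using that pos by (simp add: less_imp_le)
  have "(\<Sum>e\<in>E. w e * q e)\<^sup>2 = (\<Sum>e\<in>E. w e) * (\<Sum>e\<in>E. w e * (q e)\<^sup>2)
      \<longleftrightarrow> (\<Sum>i\<in>E. \<Sum>j\<in>E. w i * w j * (q i - q j)\<^sup>2) = 0"
    unfolding weighted_variance_identity by auto
  also have "\<dots> \<longleftrightarrow> (\<forall>i\<in>E. \<forall>j\<in>E. w i * w j * (q i - q j)\<^sup>2 = 0)"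
    using \<open>finite E\<close> nonneg by (simp add: sum_nonneg_eq_0_iff sum_nonneg)
  also have "\<dots> \<longleftrightarrow> (\<forall>i\<in>E. \<forall>j\<in>E. q i = q j)"
    using pos by (metis eq_iff_diff_eq_0 less_numeral_extra(3) mult_eq_0_iff power_zero_numeral
        zero_eq_power2)
  finally show ?thesis .
qed

section \<open>Edges and degrees\<close>

context pair_graph
begin

lemma sym_parcs: "(u, v) \<in> parcs G \<Longrightarrow> (v, u) \<in> parcs G"
  using arcs_symmetric by blast

lemma uedgeI: "(u, v) \<in> parcs G \<Longrightarrow> {u, v} \<in> uedges G"
  unfolding uedges_def by blast

lemma uedgeE:
  assumes "e \<in> uedges G"
  obtains u v where "e = {u, v}" "(u, v) \<in> parcs G" "u \<noteq> v"
  using assms pair_no_loops unfolding uedges_def by fastforce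

lemma uedges_subset_verts: "e \<in> uedges G \<Longrightarrow> e \<subseteq> pverts G"
  by (elim uedgeE) (auto dest: in_arcsD1 in_arcsD2)

lemma finite_uedges: "finite (uedges G)"
  by (rule finite_subset[of _ "Pow (pverts G)"])
     (use uedges_subset_verts pair_finite_verts in auto)

text \<open>
  Sending an arc that leaves \<open>v\<close> to its underlying edge is a bijection onto the edges at \<open>v\<close>.
  In this way the degree, which is defined by arcs, counts edges.
\<close>

lemma card_uedges_at: "card {e \<in> uedges G. v \<in> e} = vdegree G v"
proof -
  have "bij_betw (\<lambda>(x, y). {x, y}) (out_arcs (with_proj G) v) {e \<in> uedges G. v \<in> e}"
    unfolding bij_betw_def
  proof
    show "inj_on (\<lambda>(x, y). {x, y}) (out_arcs (with_proj G) v)"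
      by (auto simp: inj_on_def doubleton_eq_iff)
    show "(\<lambda>(x, y). {x, y}) ` out_arcs (with_proj G) v = {e \<in> uedges G. v \<in> e}"
    proof (intro subset_antisym subsetI)
      fix e assume "e \<in> {e \<in> uedges G. v \<in> e}"
      then obtain x y where "e = {x, y}" "(x, y) \<in> parcs G" "v = x \<or> v = y"
        by (auto elim: uedgeE)
      then have "\<exists>z. e = {v, z} \<and> (v, z) \<in> parcs G"
        using sym_parcs insert_commute by metis
      then obtain z where "e = {v, z}" "(v, z) \<in> parcs G"
        by blast
      then show "e \<in> (\<lambda>(x, y). {x, y}) ` out_arcs (with_proj G) v"
        by (intro image_eqI[of _ _ "(v, z)"]) auto
    qed (auto intro: uedgeI)
  qed
  then have "card (out_arcs (with_proj G) v) = card {e \<in> uedges G. v \<in> e}"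
    by (rule bij_betw_same_card)
  then show ?thesis
    unfolding vdegree_def out_degree_def by (rule sym)
qed

lemma vdegree_pos:
  assumes "(u, v) \<in> parcs G"
  shows "vdegree G u > 0"
proof -
  have "{u, v} \<in> {e \<in> uedges G. u \<in> e}"
    using assms by (simp add: uedgeI)
  then show ?thesis
    using finite_uedges by (auto simp flip: card_uedges_at simp: card_gt_0_iff)
qed

lemma sum_degrees_pos:
  assumes "e \<in> uedges G"
  shows "(\<Sum>w\<in>e. real (vdegree G w)) > 0"
  using assms
  by (elim uedgeE) (auto dest: vdegree_pos intro: add_pos_nonneg)

text \<open>
  Double counting of the incident pairs of a vertex \<open>v\<close> and an edge, each with weight
  \<open>d v\<close>: a vertex lies on \<open>d v\<close> edges, so it contributes \<open>(d v)\<^sup>2\<close> in total.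
\<close>

lemma first_zagreb_eq_sum_uedges:
  "first_zagreb G = (\<Sum>e\<in>uedges G. \<Sum>w\<in>e. real (vdegree G w))"
proof -
  have "(\<Sum>e\<in>uedges G. \<Sum>w\<in>e. real (vdegree G w))
      = (\<Sum>e\<in>uedges G. \<Sum>w\<in>{w \<in> pverts G. w \<in> e}. real (vdegree G w))"
    using uedges_subset_verts by (intro sum.cong) auto
  also have "\<dots> = (\<Sum>w\<in>pverts G. \<Sum>e\<in>{e \<in> uedges G. w \<in> e}. real (vdegree G w))"
    using finite_uedges pair_finite_verts by (rule sum.swap_restrict)
  also have "\<dots> = first_zagreb G"
    by (simp add: first_zagreb_def card_uedges_at power2_eq_square)
  finally show ?thesis by simp
qed

section \<open>The indices as weighted sums\<close>

lemma diminished_sombor_eq: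
  "diminished_sombor G
    = (\<Sum>e\<in>uedges G. 1 / (\<Sum>w\<in>e. real (vdegree G w)) * sqrt (\<Sum>w\<in>e. (real (vdegree G w))\<^sup>2))"
  by (simp add: diminished_sombor_def)

lemma harmonic_index_eq:
  "harmonic_index G / 2 = (\<Sum>e\<in>uedges G. 1 / (\<Sum>w\<in>e. real (vdegree G w)))"
  by (simp add: harmonic_index_def sum_divide_distrib)

lemma first_zagreb_minus_inverse_sum_index_eq:
  "first_zagreb G - 2 * inverse_sum_index G
    = (\<Sum>e\<in>uedges G. 1 / (\<Sum>w\<in>e. real (vdegree G w)) * (sqrt (\<Sum>w\<in>e. (real (vdegree G w))\<^sup>2))\<^sup>2)"
proof -
  have "(\<Sum>w\<in>e. real (vdegree G w))
        - 2 * ((\<Prod>w\<in>e. real (vdegree G w)) / (\<Sum>w\<in>e. real (vdegree G w)))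
      = 1 / (\<Sum>w\<in>e. real (vdegree G w)) * (sqrt (\<Sum>w\<in>e. (real (vdegree G w))\<^sup>2))\<^sup>2"
    if e: "e \<in> uedges G" for e
  proof -
    obtain u v where uv: "e = {u, v}" "u \<noteq> v"
      using e by (elim uedgeE)
    have "real (vdegree G u) + real (vdegree G v) > 0"
      using sum_degrees_pos[OF e] uv by simp
    then show ?thesis
      using uv by (simp add: field_simps power2_eq_square)
  qed
  then show ?thesis
    by (simp add: first_zagreb_eq_sum_uedges inverse_sum_index_def sum_distrib_left
        flip: sum_subtractf)
qed

section \<open>Graphs with constant sum of squared degrees on the edges\<close>

text \<open>
  A walk carries the degrees along: a step from a vertex of degree \<open>a\<close> can only lead to degree
  \<open>b\<close>, and conversely, because \<open>(d u)\<^sup>2\<close> determines \<open>(d v)\<^sup>2 = a\<^sup>2 + b\<^sup>2 - (d u)\<^sup>2\<close>.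
\<close>

lemma degree_two_valued:
  assumes const: "\<And>u v. (u, v) \<in> parcs G \<Longrightarrow> (vdegree G u)\<^sup>2 + (vdegree G v)\<^sup>2 = a\<^sup>2 + b\<^sup>2"
    and x: "vdegree G x = a" and reach: "x \<rightarrow>\<^sup>*\<^bsub>with_proj G\<^esub> v"
  shows "vdegree G v = a \<or> vdegree G v = b"
  using reach
proof (induction rule: reachable_induct)
  case base
  then show ?case by (simp add: x)
next
  case (step u v)
  then have "(vdegree G u)\<^sup>2 + (vdegree G v)\<^sup>2 = a\<^sup>2 + b\<^sup>2"
    by (intro const) simp
  then show ?case
    using step.IH by auto
qed

lemma constant_square_sum_iff:
  assumes "connected (with_proj G)"
  shows "(\<exists>c. \<forall>(u, v)\<in>parcs G. (vdegree G u)\<^sup>2 + (vdegree G v)\<^sup>2 = c)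
    \<longleftrightarrow> regular_graph G \<or> bipartite_semiregular G"
    (is "?const \<longleftrightarrow> _")
proof
  assume ?const
  then obtain c where c: "\<And>u v. (u, v) \<in> parcs G \<Longrightarrow> (vdegree G u)\<^sup>2 + (vdegree G v)\<^sup>2 = c"
    by blast
  show "regular_graph G \<or> bipartite_semiregular G"
  proof (cases "parcs G = {}")
    case True
    then have "vdegree G v = 0" for v
      by (simp add: vdegree_def out_degree_def out_arcs_def)
    then show ?thesis
      by (auto simp: regular_graph_def)
  next
    case False
    then obtain x y where xy: "(x, y) \<in> parcs G" by auto
    define a b where "a = vdegree G x" and "b = vdegree G y"
    have const: "(vdegree G u)\<^sup>2 + (vdegree G v)\<^sup>2 = a\<^sup>2 + b\<^sup>2" if "(u, v) \<in> parcs G" for u v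
      using c[OF that] c[OF xy] by (simp add: a_def b_def)
    have two: "vdegree G v = a \<or> vdegree G v = b" if "v \<in> pverts G" for v
    proof (rule degree_two_valued[OF const])
      have "x \<rightarrow>\<^sup>*\<^bsub>with_proj (mk_symmetric (with_proj G))\<^esub> v"
        using assms that in_arcsD1[OF xy]
        by (auto simp: connected_def strongly_connected_def)
      then show "x \<rightarrow>\<^sup>*\<^bsub>with_proj G\<^esub> v"
        by (simp add: reachable_mk_symmetric_eq pair_sym_arcs)
    qed (auto simp: a_def)
    show ?thesis
    proof (cases "a = b")
      case True
      then show ?thesis
        using two by (auto simp: regular_graph_def)
    next
      case False
      define A B where "A = {v \<in> pverts G. vdegree G v = a}"
        and "B = {v \<in> pverts G. vdegree G v = b}"
      have "parcs G \<subseteq> A \<times> B \<union> B \<times> A"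
      proof (rule subrelI)
        fix u v assume uv: "(u, v) \<in> parcs G"
        then have V: "u \<in> pverts G" "v \<in> pverts G"
          by (auto dest: in_arcsD1 in_arcsD2)
        have "vdegree G u \<noteq> vdegree G v"
          using const[OF uv] two[OF V(1)] False by auto
        then show "(u, v) \<in> A \<times> B \<union> B \<times> A"
          using two V by (auto simp: A_def B_def)
      qed
      moreover have "A \<union> B = pverts G" "A \<inter> B = {}"
        using two False by (auto simp: A_def B_def)
      ultimately have "bipartition G A B"
        by (simp add: bipartition_def)
      then have "bipartite_semiregular G"
        unfolding bipartite_semiregular_def
        by (intro exI[of _ A] exI[of _ B] exI[of _ a] exI[of _ b]) (simp add: A_def B_def)
      then show ?thesis ..
    qed
  qed
next
  assume "regular_graph G \<or> bipartite_semiregular G"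
  then show ?const
  proof
    assume "regular_graph G"
    then obtain k where "\<forall>v\<in>pverts G. vdegree G v = k"
      by (auto simp: regular_graph_def)
    then show ?const
      by (intro exI[of _ "k\<^sup>2 + k\<^sup>2"]) (auto simp: in_arcsD1 in_arcsD2)
  next
    assume "bipartite_semiregular G"
    then obtain A B a b where "parcs G \<subseteq> A \<times> B \<union> B \<times> A"
      and "\<forall>v\<in>A. vdegree G v = a" "\<forall>v\<in>B. vdegree G v = b"
      by (auto simp: bipartite_semiregular_def bipartition_def)
    then show ?const
      by (intro exI[of _ "a\<^sup>2 + b\<^sup>2"]) fastforce
  qed
qed

text \<open>
  Links the equality case of the Cauchy-Schwarz inequality, which concerns square roots on
  unordered edges, to the condition on arcs and natural numbers that walks can carry along.
\<close>

lemma sqrt_square_sum_constant_iff: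
  "(\<forall>e\<in>uedges G. \<forall>f\<in>uedges G.
      sqrt (\<Sum>w\<in>e. (real (vdegree G w))\<^sup>2) = sqrt (\<Sum>w\<in>f. (real (vdegree G w))\<^sup>2))
    \<longleftrightarrow> (\<exists>c. \<forall>(u, v)\<in>parcs G. (vdegree G u)\<^sup>2 + (vdegree G v)\<^sup>2 = c)"
proof -
  define h where "h e = (\<Sum>w\<in>e. (vdegree G w)\<^sup>2)" for e
  have h: "h {u, v} = (vdegree G u)\<^sup>2 + (vdegree G v)\<^sup>2" if "(u, v) \<in> parcs G" for u v
    using pair_no_loops[OF that] by (simp add: h_def)
  have "(\<Sum>w\<in>e. (real (vdegree G w))\<^sup>2) = real (h e)" for e
    by (simp add: h_def)
  then have "?thesis \<longleftrightarrow> ((\<forall>e\<in>uedges G. \<forall>f\<in>uedges G. h e = h f)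
      \<longleftrightarrow> (\<exists>c. \<forall>(u, v)\<in>parcs G. (vdegree G u)\<^sup>2 + (vdegree G v)\<^sup>2 = c))"
    by simp
  moreover have "(\<forall>e\<in>uedges G. \<forall>f\<in>uedges G. h e = h f) \<longleftrightarrow> (\<exists>c. \<forall>e\<in>uedges G. h e = c)"
    by metis
  moreover have "(\<forall>e\<in>uedges G. h e = c)
      \<longleftrightarrow> (\<forall>(u, v)\<in>parcs G. (vdegree G u)\<^sup>2 + (vdegree G v)\<^sup>2 = c)" for c
  proof -
    have "(\<forall>e\<in>uedges G. h e = c) \<longleftrightarrow> (\<forall>(u, v)\<in>parcs G. h {u, v} = c)"
      unfolding uedges_def by blast
    also have "\<dots> \<longleftrightarrow> (\<forall>(u, v)\<in>parcs G. (vdegree G u)\<^sup>2 + (vdegree G v)\<^sup>2 = c)"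
      by (intro ball_cong) (auto simp: h)
    finally show ?thesis .
  qed
  ultimately show ?thesis by simp
qed

end

section \<open>The bound on the Diminished Sombor index\<close>

theorem theorem8:
  fixes G :: "'a pair_pre_digraph"
  assumes "pair_graph G" and "connected (with_proj G)"
  shows "diminished_sombor G
           \<le> sqrt (harmonic_index G / 2 * (first_zagreb G - 2 * inverse_sum_index G)) \<and>
         (diminished_sombor G
           = sqrt (harmonic_index G / 2 * (first_zagreb G - 2 * inverse_sum_index G))
          \<longleftrightarrow> regular_graph G \<or> bipartite_semiregular G)"
proof -
  interpret pair_graph G by fact
  define w where "w e = 1 / (\<Sum>v\<in>e. real (vdegree G v))" for e
  define q where "q e = sqrt (\<Sum>v\<in>e. (real (vdegree G v))\<^sup>2)" for e
  let ?X = "harmonic_index G / 2 * (first_zagreb G - 2 * inverse_sum_index G)"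
  have w: "w e > 0" if "e \<in> uedges G" for e
    using sum_degrees_pos[OF that] by (simp add: w_def)
  have dso: "diminished_sombor G = (\<Sum>e\<in>uedges G. w e * q e)"
    by (simp add: diminished_sombor_eq w_def q_def)
  have X: "?X = (\<Sum>e\<in>uedges G. w e) * (\<Sum>e\<in>uedges G. w e * (q e)\<^sup>2)"
    by (simp only: harmonic_index_eq first_zagreb_minus_inverse_sum_index_eq w_def q_def)
  have nonneg: "diminished_sombor G \<ge> 0"
    using w unfolding dso by (intro sum_nonneg mult_nonneg_nonneg)
      (auto simp: q_def sum_nonneg less_imp_le)
  have le: "(diminished_sombor G)\<^sup>2 \<le> ?X"
    unfolding dso X using w by (rule weighted_Cauchy_Schwarz)
  have "diminished_sombor G = sqrt ?X \<longleftrightarrow> (diminished_sombor G)\<^sup>2 = ?X"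
    using nonneg le by (auto intro: real_sqrt_unique[symmetric] simp: order_trans[OF zero_le_power2])
  also have "\<dots> \<longleftrightarrow> (\<forall>e\<in>uedges G. \<forall>f\<in>uedges G. q e = q f)"
    unfolding dso X using finite_uedges w by (rule weighted_Cauchy_Schwarz_eq_iff)
  also have "\<dots> \<longleftrightarrow> regular_graph G \<or> bipartite_semiregular G"
    unfolding q_def sqrt_square_sum_constant_iff
    using assms(2) by (rule constant_square_sum_iff)
  finally show ?thesis
    using le by (auto intro: real_le_rsqrt)
qed

end
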